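(* Let $F$ be a field of characteristic zero, let $\mathcal{A}$ be a KV-algebra over $F$ and let $W$ be an $\mathcal{A}$-KV-module. Then the coboundary operator $\delta : C_q(\mathcal{A},W)\to C_{q+1}(\mathcal{A},W)$ ($q\ge 1$) satisfies $\delta\circ\delta=0$, i.e. $\delta(\delta f)=0$ in $C_{q+2}(\mathcal{A},W)$ for every $q\geq 1$ and every $f\in C_q(\mathcal{A},W)$.
   Context: A KV-algebra over $F$ is an $F$-vector space $\mathcal{A}$ with a bilinear multiplication $(a,b)\mapsto ab$ such that the associator $(a,b,c)=(ab)c-a(bc)$ satisfies $(a,b,c)=(b,a,c)$ for all $a,b,c\in\mathcal{A}$. An $\mathcal{A}$-KV-module is an $F$-vector space $W$ with bilinear maps $\mathcal{A}\times W\to W$, $(a,w)\mapsto aw$, and $W\times\mathcal{A}\to W$, $(w,a)\mapsto wa$, such that for all $a,b\in\mathcal{A}$, $w\in W$: $(a,b,w)=(b,a,w)$ and $(a,w,b)=(w,a,b)$, where $(a,b,w)=(ab)w-a(bw)$, $(a,w,b)=(aw)b-a(wb)$, $(w,a,b)=(wa)b-w(ab)$. For $q\ge1$, $C_q(\mathcal{A},W)$ is the space of all $q$-linear maps from $\mathcal{A}$ to $W$. For $f\in C_q(\mathcal{A},W)$, the coboundary $\delta f\in C_{q+1}(\mathcal{A},W)$ is $$(\delta f)(a_1,\dots,a_{q+1})=\sum_{j=1}^{q}(-1)^j\Big\{(a_jf)(a_1,\dots,\widehat{a_j},\dots,a_{q+1})+\big(f(a_1,\dots,\widehat{a_j},\dots,a_q,a_j)\big)a_{q+1}\Big\},$$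 where a hat means omission and $(af)(b_1,\dots,b_q)=a\big(f(b_1,\dots,b_q)\big)-\sum_{i=1}^q f(b_1,\dots,ab_i,\dots,b_q)$. *)

theory Defs
  imports Complex_Main
begin

locale KV_algebra = vector_space scaleA
  for scaleA :: "'f::field \<Rightarrow> 'a::ab_group_add \<Rightarrow> 'a" +
  fixes mul :: "'a \<Rightarrow> 'a \<Rightarrow> 'a"  (infixl "\<cdot>" 70)
  assumes linear_mul_left: "Vector_Spaces.linear scaleA scaleA (\<lambda>a. a \<cdot> b)"
    and linear_mul_right: "Vector_Spaces.linear scaleA scaleA (\<lambda>b. a \<cdot> b)"
    and associator_sym: "(a \<cdot> b) \<cdot> c - a \<cdot> (b \<cdot> c) = (b \<cdot> a) \<cdot> c - b \<cdot> (a \<cdot> c)"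

locale KV_module = KV_algebra scaleA mul + W: vector_space scaleW
  for scaleA :: "'f::field \<Rightarrow> 'a::ab_group_add \<Rightarrow> 'a"
    and mul :: "'a \<Rightarrow> 'a \<Rightarrow> 'a"  (infixl "\<cdot>" 70)
    and scaleW :: "'f \<Rightarrow> 'w::ab_group_add \<Rightarrow> 'w" +
  fixes lact :: "'a \<Rightarrow> 'w \<Rightarrow> 'w"  (infixr "\<rhd>" 70)
    and ract :: "'w \<Rightarrow> 'a \<Rightarrow> 'w"  (infixl "\<lhd>" 70)
  assumes linear_lact_left: "Vector_Spaces.linear scaleA scaleW (\<lambda>a. a \<rhd> w)"
    and linear_lact_right: "Vector_Spaces.linear scaleW scaleW (\<lambda>w. a \<rhd> w)"
    and linear_ract_left: "Vector_Spaces.linear scaleW scaleW (\<lambda>w. w \<lhd> a)"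
    and linear_ract_right: "Vector_Spaces.linear scaleA scaleW (\<lambda>a. w \<lhd> a)"
    and module_associator_left:
      "(a \<cdot> b) \<rhd> w - a \<rhd> (b \<rhd> w) = (b \<cdot> a) \<rhd> w - b \<rhd> (a \<rhd> w)"
    and module_associator_mid:
      "(a \<rhd> w) \<lhd> b - a \<rhd> (w \<lhd> b) = (w \<lhd> a) \<lhd> b - w \<lhd> (a \<cdot> b)"
begin

text \<open>
  A map of \<open>q\<close> arguments is a function on lists of length \<open>q\<close>, normalised to \<open>0\<close> on lists of any
  other length, so that equality of cochains is equality of functions.
\<close>
definition cochains :: "nat \<Rightarrow> ('a list \<Rightarrow> 'w) set" where
  "cochains q = {f. (\<forall>xs. length xs \<noteq> q \<longrightarrow> f xs = 0) \<and>
     (\<forall>xs i. length xs = q \<longrightarrow> i < q \<longrightarrow>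
        Vector_Spaces.linear scaleA scaleW (\<lambda>x. f (xs[i := x])))}"

definition act :: "'a \<Rightarrow> ('a list \<Rightarrow> 'w) \<Rightarrow> 'a list \<Rightarrow> 'w" where
  "act a f bs = a \<rhd> f bs - (\<Sum>i<length bs. f (bs[i := a \<cdot> bs ! i]))"

definition omit :: "nat \<Rightarrow> 'a list \<Rightarrow> 'a list" where
  "omit j xs = take j xs @ drop (Suc j) xs"

text \<open>
  List positions start at \<open>0\<close>: position \<open>j\<close> holds \<open>a\<^sub>j\<^sub>+\<^sub>1\<close>, whence the exponent \<open>Suc j\<close>. For a list of
  length \<open>q + 1\<close>, \<open>butlast\<close> gives \<open>a\<^sub>1, \<dots>, a\<^sub>q\<close> and \<open>last\<close> gives \<open>a\<^sub>q\<^sub>+\<^sub>1\<close>. The degree \<open>q\<close> is read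
  off the list; if \<open>f\<close> is a \<open>q\<close>-cochain with \<open>q \<ge> 1\<close>, all terms vanish on lists of length other
  than \<open>q + 1\<close>.
\<close>
definition coboundary :: "('a list \<Rightarrow> 'w) \<Rightarrow> 'a list \<Rightarrow> 'w" where
  "coboundary f xs = (\<Sum>j<length xs - 1. scaleW ((-1) ^ Suc j)
     (act (xs ! j) f (omit j xs) + f (omit j (butlast xs) @ [xs ! j]) \<lhd> last xs))"

end

end

theory Submission
  imports Defs
begin

text \<open>
  Read a \<open>q\<close>-cochain \<open>f\<close> as a \<open>(q - 1)\<close>-linear map with values in \<open>H = Hom(A, W)\<close>, by setting the
  last argument apart. On \<open>H\<close> the algebra acts by
  \<open>(a \<phi>)(y) = a \<phi>(y) - \<phi>(a y) + \<phi>(a) y\<close>, and on \<open>A\<close> by left multiplication. Together they act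
  on cochains like a derivation; this action is \<open>curried_act\<close>. It absorbs the summand with the right
  action in the definition of \<open>\<delta>\<close>, so that \<open>\<delta>\<close> becomes
  \[ (\<delta> f)(x) = \sum_j (-1)^j (x_j f)(\ldots, \widehat{x_j}, \ldots), \]
  where the last entry of \<open>x\<close> is never omitted (\<open>coboundary_eq_sum_curried_act\<close>).

  Two facts then give \<open>\<delta> \<delta> = 0\<close>. First, the associator \<open>(a, b, f) = (a b) f - a (b f)\<close> of this action
  is symmetric in \<open>a\<close> and \<open>b\<close>, like those of \<open>A\<close> and \<open>W\<close> (\<open>act_associator_sym\<close>): this uses all
  three KV identities, and it says that the commutator Lie algebra of \<open>A\<close> acts on cochains.
  Second, when \<open>a\<close> acts on \<open>\<delta> f\<close>, substituting \<open>a b\<^sub>k\<close> for \<open>b\<^sub>k\<close> in the summand that omits position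
  \<open>k\<close> produces exactly the term that turns \<open>a (b\<^sub>k f)\<close> into an associator
  (\<open>curried_act_coboundary\<close>). Hence \<open>\<delta> (\<delta> f)\<close> is a sum over ordered pairs of distinct positions
  \<open>(j, l)\<close> of the symmetric expressions \<open>(x\<^sub>j, x\<^sub>l, f)\<close>, taken on the remaining entries, with a sign that
  changes when \<open>j\<close> and \<open>l\<close> are exchanged, and it cancels in pairs.
\<close>

section \<open>Omitted positions and alternating double sums\<close>

text \<open>
  The coface map of the simplex category: the original position of the \<open>k\<close>-th entry that is left once
  position \<open>j\<close> has been omitted.
\<close>
definition skip :: "nat \<Rightarrow> nat \<Rightarrow> nat" where
  "skip j k = (if k < j then k else Suc k)"

lemma skip_neq [simp]: "skip j k \<noteq> j" "j \<noteq> skip j k"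
  by (auto simp: skip_def)

lemma skip_less: "Suc k < n \<Longrightarrow> skip j k < n"
  by (auto simp: skip_def)

lemma skip_eq_iff [simp]: "skip j k = skip j l \<longleftrightarrow> k = l"
  by (auto simp: skip_def)

lemma sum_split_skip:
  fixes g :: "nat \<Rightarrow> 'b::comm_monoid_add"
  assumes "j < Suc n"
  shows "(\<Sum>i<Suc n. g i) = g j + (\<Sum>k<n. g (skip j k))"
proof -
  have "{..<Suc n} - {j} = skip j ` {..<n}"
  proof (intro equalityI subsetI)
    fix i assume "i \<in> {..<Suc n} - {j}"
    then have "i = skip j (if i < j then i else i - 1)" "(if i < j then i else i - 1) < n"
      using assms by (auto simp: skip_def)
    then show "i \<in> skip j ` {..<n}" by blast
  qed (auto simp: skip_less)
  moreover have "inj_on (skip j) {..<n}" by (simp add: inj_on_def)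
  ultimately have "(\<Sum>i\<in>{..<Suc n} - {j}. g i) = (\<Sum>k<n. g (skip j k))"
    by (simp add: sum.reindex)
  then show ?thesis
    using assms by (simp add: sum.remove[of "{..<Suc n}" j] del: sum.lessThan_Suc)
qed

text \<open>
  Here \<open>k\<close> counts positions after the omission of \<open>j\<close>. For \<open>j \<le> k\<close> the index pairs \<open>(j, k)\<close> and
  \<open>(k + 1, j)\<close> stand for the same two original positions in either order, and each pair of
  positions arises in exactly these two ways. In the induction, the new column \<open>k = n\<close> cancels
  against the new row \<open>j = n + 1\<close>.
\<close>
lemma sum_sum_antisym_eq_0:
  fixes h :: "nat \<Rightarrow> nat \<Rightarrow> 'b::ab_group_add"
  assumes "\<And>j k. j \<le> k \<Longrightarrow> k < n \<Longrightarrow> h (Suc k) j = - h j k"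
  shows "(\<Sum>j<Suc n. \<Sum>k<n. h j k) = 0"
  using assms
proof (induction n)
  case (Suc n)
  have "(\<Sum>j<Suc (Suc n). \<Sum>k<Suc n. h j k)
      = (\<Sum>j<Suc n. (\<Sum>k<n. h j k) + h j n) + (\<Sum>k<Suc n. h (Suc n) k)"
    by (simp only: sum.lessThan_Suc)
  also have "(\<Sum>k<Suc n. h (Suc n) k) = (\<Sum>k<Suc n. - h k n)"
    using Suc.prems by (intro sum.cong) auto
  also have "(\<Sum>j<Suc n. (\<Sum>k<n. h j k) + h j n) + (\<Sum>k<Suc n. - h k n)
      = (\<Sum>j<Suc n. \<Sum>k<n. h j k)"
    by (simp only: sum.distrib sum_negf) simp
  also have "\<dots> = 0"
    using Suc by auto
  finally show ?case .
qed simp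

context KV_module
begin

lemma length_omit: "j < length xs \<Longrightarrow> length (omit j xs) = length xs - 1"
  by (simp add: omit_def)

lemma nth_omit: "Suc k < length xs \<Longrightarrow> j < length xs \<Longrightarrow> omit j xs ! k = xs ! skip j k"
  by (auto simp: omit_def skip_def nth_append min_def)

lemma omit_update_self: "j < length xs \<Longrightarrow> omit j (xs[j := x]) = omit j xs"
  by (rule nth_equalityI) (auto simp: length_omit nth_omit)

lemma omit_update_skip:
  "j < length xs \<Longrightarrow> Suc k < length xs \<Longrightarrow> omit j (xs[skip j k := x]) = (omit j xs)[k := x]"
  by (rule nth_equalityI) (auto simp: length_omit nth_omit nth_list_update skip_less)

lemma omit_omit:
  "j \<le> k \<Longrightarrow> Suc k < length xs \<Longrightarrow> omit j (omit (Suc k) xs) = omit k (omit j xs)"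
  by (rule nth_equalityI) (auto simp: length_omit nth_omit skip_def)

section \<open>Linearity\<close>

lemmas lin_add = module_hom.add[OF linear_iff_module_hom[THEN iffD1]]
  and lin_diff = module_hom.diff[OF linear_iff_module_hom[THEN iffD1]]
  and lin_zero = module_hom.zero[OF linear_iff_module_hom[THEN iffD1]]
  and lin_scale = module_hom.scale[OF linear_iff_module_hom[THEN iffD1]]
  and lin_sum = module_hom.sum[OF linear_iff_module_hom[THEN iffD1]]

lemmas lact_lin = lin_add[OF linear_lact_right] lin_diff[OF linear_lact_right]
    lin_zero[OF linear_lact_right] lin_scale[OF linear_lact_right] lin_sum[OF linear_lact_right]
  and ract_lin = lin_add[OF linear_ract_left] lin_diff[OF linear_ract_left]
    lin_zero[OF linear_ract_left] lin_scale[OF linear_ract_left] lin_sum[OF linear_ract_left]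

sublocale AW: vector_space_pair scaleA scaleW ..

lemma cochain_linear:
  assumes "f \<in> cochains q" "length xs = q" "i < q"
  shows "Vector_Spaces.linear scaleA scaleW (\<lambda>x. f (xs[i := x]))"
  using assms by (simp add: cochains_def)

lemma cochain_eq_0: "f \<in> cochains q \<Longrightarrow> length xs \<noteq> q \<Longrightarrow> f xs = 0"
  by (simp add: cochains_def)

section \<open>The action on curried cochains\<close>

text \<open>
  The action on \<open>(q - 1)\<close>-linear maps with values in \<open>Hom(A, W)\<close>: the last variable is the argument
  of the homomorphism, so it contributes the extra summand with the right action.
\<close>
definition curried_act :: "'a \<Rightarrow> ('a list \<Rightarrow> 'w) \<Rightarrow> 'a list \<Rightarrow> 'w" where
  "curried_act a f bs =
     act a f bs + f (bs[length bs - 1 := a]) \<lhd> (bs ! (length bs - 1))"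

text \<open>
  Since \<open>j\<close> is never the last position, replacing the last entry of \<open>omit j xs\<close> by \<open>xs ! j\<close> gives the
  argument list of the right-action summand of the coboundary.
\<close>
lemma coboundary_eq_sum_curried_act:
  "coboundary f xs =
    (\<Sum>j<length xs - 1. scaleW ((-1) ^ Suc j) (curried_act (xs ! j) f (omit j xs)))"
  unfolding coboundary_def
proof (rule sum.cong[OF refl])
  fix j assume "j \<in> {..<length xs - 1}"
  then have j: "Suc j < length xs" by auto
  have "omit j (butlast xs) @ [xs ! j] = (omit j xs)[length (omit j xs) - 1 := xs ! j]"
    using j by (intro nth_equalityI)
      (auto simp: length_omit nth_omit nth_append nth_butlast nth_list_update skip_def)
  moreover have "last xs = omit j xs ! (length (omit j xs) - 1)"
  proof -
    have "xs \<noteq> []" using j by auto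
    then show ?thesis using j
      by (auto simp: length_omit nth_omit last_conv_nth skip_def Suc_diff_Suc)
  qed
  ultimately show "scaleW ((-1) ^ Suc j)
      (act (xs ! j) f (omit j xs) + f (omit j (butlast xs) @ [xs ! j]) \<lhd> last xs)
    = scaleW ((-1) ^ Suc j) (curried_act (xs ! j) f (omit j xs))"
    by (simp add: curried_act_def)
qed

lemma curried_act_linear_left:
  assumes "f \<in> cochains q" "length bs = q" "q \<ge> 1"
  shows "Vector_Spaces.linear scaleA scaleW (\<lambda>a. curried_act a f bs)"
proof -
  have "Vector_Spaces.linear scaleA scaleW (\<lambda>a. f (bs[i := a \<cdot> bs ! i]))" if "i < q" for i
    using Vector_Spaces.linear_compose[OF linear_mul_left cochain_linear[OF assms(1,2) that]]
    by (simp add: o_def)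
  moreover have "Vector_Spaces.linear scaleA scaleW (\<lambda>a. f (bs[q - 1 := a]) \<lhd> b)" for b
    using Vector_Spaces.linear_compose[OF cochain_linear[OF assms(1,2), of "q - 1"] linear_ract_left]
      assms(3) by (simp add: o_def)
  ultimately show ?thesis
    unfolding curried_act_def act_def assms(2)
    by (intro AW.linear_compose_add AW.linear_compose_sub AW.linear_compose_sum linear_lact_left)
      auto
qed

lemma curried_act_cochain:
  assumes f: "f \<in> cochains q" and q: "q \<ge> 1"
  shows "curried_act a f \<in> cochains q"
proof -
  have "curried_act a f bs = 0" if "length bs \<noteq> q" for bs
    using cochain_eq_0[OF f] that by (simp add: curried_act_def act_def lact_lin ract_lin)
  moreover have "Vector_Spaces.linear scaleA scaleW (\<lambda>x. curried_act a f (bs[i := x]))"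
    if bs: "length bs = q" and i: "i < q" for bs i
  proof -
    note lin = cochain_linear[OF f _ i]
    \<comment> \<open>The varied entry keeps its place in each summand, except in the summand \<open>k = i\<close>, where it is first
      multiplied by \<open>a\<close>, and in the last one for \<open>i = q - 1\<close>, where it becomes the right factor.\<close>
    have "Vector_Spaces.linear scaleA scaleW (\<lambda>x. a \<rhd> f (bs[i := x]))"
      using Vector_Spaces.linear_compose[OF lin linear_lact_right] bs by (simp add: o_def)
    moreover have "Vector_Spaces.linear scaleA scaleW
        (\<lambda>x. f (bs[i := x, k := a \<cdot> bs[i := x] ! k]))" if k: "k < q" for k
    proof (cases "k = i")
      case True
      then show ?thesis
        using Vector_Spaces.linear_compose[OF linear_mul_right lin] bs i by (simp add: o_def)
    next
      case False
      then show ?thesis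
        using lin[of "bs[k := a \<cdot> bs ! k]"] bs by (simp add: list_update_swap)
    qed
    moreover have "Vector_Spaces.linear scaleA scaleW
        (\<lambda>x. f (bs[i := x, q - 1 := a]) \<lhd> (bs[i := x] ! (q - 1)))"
    proof (cases "i = q - 1")
      case True
      then show ?thesis
        using linear_ract_right bs i by simp
    next
      case False
      then show ?thesis
        using Vector_Spaces.linear_compose[OF lin[of "bs[q - 1 := a]"] linear_ract_left] bs
        by (simp add: o_def list_update_swap)
    qed
    ultimately show ?thesis
      unfolding curried_act_def act_def length_list_update bs
      by (intro AW.linear_compose_add AW.linear_compose_sub AW.linear_compose_sum) auto
  qed
  ultimately show ?thesis by (simp add: cochains_def)
qed

lemma coboundary_cochain:
  assumes f: "f \<in> cochains q" and q: "q \<ge> 1"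
  shows "coboundary f \<in> cochains (q + 1)"
proof -
  have "coboundary f xs = 0" if "length xs \<noteq> q + 1" for xs
    unfolding coboundary_eq_sum_curried_act
    using cochain_eq_0[OF curried_act_cochain[OF f q]] that
    by (intro sum.neutral) (auto simp: length_omit)
  moreover have "Vector_Spaces.linear scaleA scaleW (\<lambda>x. coboundary f (xs[i := x]))"
    if xs: "length xs = q + 1" and i: "i < q + 1" for xs i
  proof -
    have "Vector_Spaces.linear scaleA scaleW
        (\<lambda>x. curried_act (xs[i := x] ! j) f (omit j (xs[i := x])))" if j: "j < q" for j
    proof (cases "i = j")
      case True
      then show ?thesis
        using curried_act_linear_left[OF f _ q, of "omit j xs"] xs j
        by (simp add: omit_update_self length_omit)
    next
      case False
      then obtain k where "k < q" "i = skip j k"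
        using i j by (intro that[of "if i < j then i else i - 1"]) (auto simp: skip_def)
      then show ?thesis
        using cochain_linear[OF curried_act_cochain[OF f q], of "omit j xs" k] xs j
        by (simp add: omit_update_skip length_omit)
    qed
    then show ?thesis
      unfolding coboundary_eq_sum_curried_act length_list_update xs
      by (auto intro!: AW.linear_compose_sum AW.linear_compose_scale_right simp del: power_Suc)
  qed
  ultimately show ?thesis by (simp add: cochains_def)
qed

section \<open>Symmetry of the associator\<close>

definition act_associator :: "'a \<Rightarrow> 'a \<Rightarrow> ('a list \<Rightarrow> 'w) \<Rightarrow> 'a list \<Rightarrow> 'w" where
  "act_associator a b f bs = curried_act (a \<cdot> b) f bs - curried_act a (curried_act b f) bs"

text \<open>
  Expanding the two nested actions leaves four groups of terms, each matched by one identity. Only left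
  actions on \<open>W\<close>: left symmetry of \<open>W\<close>. One left action and one substitution: symmetric as it
  stands. Two substitutions: at different positions they commute, at the same position left symmetry of
  \<open>A\<close> applies. Terms with the right action: the mixed module identity.
\<close>
lemma act_associator_sym:
  assumes f: "f \<in> cochains q" and q: "q \<ge> 1" and bs: "length bs = q"
  shows "act_associator a b f bs = act_associator b a f bs"
proof -
  define m where "m = q - 1"
  have m: "m < q" "q = Suc m" using q by (auto simp: m_def)
  define y where "y = bs ! m"
  \<comment> \<open>\<open>C\<close> collects the two-fold substitutions, those by \<open>a \<cdot> b\<close> included; \<open>D\<close> everything
    that involves the right action.\<close>
  define A where "A a b = a \<rhd> (b \<rhd> f bs) - (a \<cdot> b) \<rhd> f bs" for a b
  define B where "B a b = (\<Sum>i<q. a \<rhd> f (bs[i := b \<cdot> bs ! i]))" for a b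
  define C where "C a b = (\<Sum>i<q. \<Sum>k<q. f (bs[i := a \<cdot> bs ! i, k := b \<cdot> bs[i := a \<cdot> bs ! i] ! k]))
    + (\<Sum>i<q. f (bs[i := (a \<cdot> b) \<cdot> bs ! i]))" for a b
  define D where "D a b = a \<rhd> (f (bs[m := b]) \<lhd> y) 
      - (\<Sum>i<q. f (bs[i := a \<cdot> bs ! i, m := b]) \<lhd> (bs[i := a \<cdot> bs ! i] ! m))
      + (b \<rhd> f (bs[m := a])
        - (\<Sum>k<q. f (bs[m := a, k := b \<cdot> bs[m := a] ! k])) + f (bs[m := b]) \<lhd> a) \<lhd> y
      - f (bs[m := a \<cdot> b]) \<lhd> y" for a b
  have expand: "- act_associator a b f bs = A a b - B a b - B b a + C a b + D a b" for a b
    unfolding act_associator_def A_def B_def C_def D_def curried_act_def act_def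
      length_list_update bs m_def[symmetric] y_def
    using m(1) bs
    by (simp add: lact_lin ract_lin sum.distrib sum_subtractf algebra_simps)
  have A: "A a b = A b a"
    using module_associator_left[of a b "f bs"] unfolding A_def by (metis minus_diff_eq)
  have C: "C a b = C b a"
  proof -
    have diag: "f (bs[i := b \<cdot> (a \<cdot> bs ! i)]) + f (bs[i := (a \<cdot> b) \<cdot> bs ! i])
        = f (bs[i := a \<cdot> (b \<cdot> bs ! i)]) + f (bs[i := (b \<cdot> a) \<cdot> bs ! i])" if "i < q" for i
    proof -
      have "b \<cdot> (a \<cdot> x) + (a \<cdot> b) \<cdot> x = a \<cdot> (b \<cdot> x) + (b \<cdot> a) \<cdot> x" for x
        using associator_sym[of a b x] by (simp add: algebra_simps)
      then show ?thesis
        by (simp flip: lin_add[OF cochain_linear[OF f bs that]])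
    qed
    define off where "off a b = (\<Sum>i<q. \<Sum>k<m. f (bs[i := a \<cdot> bs ! i, skip i k := b \<cdot> bs ! skip i k]))"
      for a b
    have split: "C a b = off a b + (\<Sum>i<q. f (bs[i := b \<cdot> (a \<cdot> bs ! i)]) + f (bs[i := (a \<cdot> b) \<cdot> bs ! i]))"
      for a b
    proof -
      have "(\<Sum>k<q. f (bs[i := a \<cdot> bs ! i, k := b \<cdot> bs[i := a \<cdot> bs ! i] ! k]))
         = f (bs[i := b \<cdot> (a \<cdot> bs ! i)])
           + (\<Sum>k<m. f (bs[i := a \<cdot> bs ! i, skip i k := b \<cdot> bs ! skip i k]))" if "i < q" for i
        using sum_split_skip[of i m "\<lambda>k. f (bs[i := a \<cdot> bs ! i, k := b \<cdot> bs[i := a \<cdot> bs ! i] ! k])"]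
          that bs m by simp
      then show ?thesis
        unfolding C_def off_def by (simp add: sum.distrib algebra_simps)
    qed
    have "off a b = off b a"
    proof -
      have off: "off a b = (\<Sum>i<q. \<Sum>k<q. if k = i then 0 else f (bs[i := a \<cdot> bs ! i, k := b \<cdot> bs ! k]))"
        for a b
        unfolding off_def
      proof (rule sum.cong[OF refl])
        fix i assume "i \<in> {..<q}"
        then show "(\<Sum>k<m. f (bs[i := a \<cdot> bs ! i, skip i k := b \<cdot> bs ! skip i k])) =
            (\<Sum>k<q. if k = i then 0 else f (bs[i := a \<cdot> bs ! i, k := b \<cdot> bs ! k]))"
          using sum_split_skip[of i m "\<lambda>k. if k = i then 0 else f (bs[i := a \<cdot> bs ! i, k := b \<cdot> bs ! k])"] m
          by simp
      qed
      show ?thesis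
        unfolding off
        by (subst sum.swap) (intro sum.cong refl, auto simp: list_update_swap)
    qed
    then show ?thesis
      using diag by (simp add: split)
  qed
  have D: "D a b = D b a"
  proof -
    \<comment> \<open>The sums in \<open>D\<close> contribute at position \<open>m\<close>, with a minus sign, the terms \<open>f(\<dots>, b) \<lhd> (a \<cdot> y)\<close> and
      \<open>f(\<dots>, b \<cdot> a) \<lhd> y\<close>. The mixed identity for \<open>w = f(\<dots>, b)\<close> trades
      \<open>a \<rhd> (w \<lhd> y) + (w \<lhd> a) \<lhd> y - w \<lhd> (a \<cdot> y)\<close> for \<open>(a \<rhd> w) \<lhd> y\<close>,
      after which the symmetry is visible.\<close>
    have D': "D a b = (a \<rhd> f (bs[m := b])) \<lhd> y + (b \<rhd> f (bs[m := a])) \<lhd> y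
        - (\<Sum>i<m. f (bs[i := a \<cdot> bs ! i, m := b]) \<lhd> y) - (\<Sum>i<m. f (bs[i := b \<cdot> bs ! i, m := a]) \<lhd> y)
        - f (bs[m := b \<cdot> a]) \<lhd> y - f (bs[m := a \<cdot> b]) \<lhd> y" for a b
    proof -
      have 1: "(\<Sum>i<q. f (bs[i := a \<cdot> bs ! i, m := b]) \<lhd> (bs[i := a \<cdot> bs ! i] ! m))
          = (\<Sum>i<m. f (bs[i := a \<cdot> bs ! i, m := b]) \<lhd> y) + f (bs[m := b]) \<lhd> (a \<cdot> y)"
        using bs by (simp add: m(2) y_def)
      have 2: "(\<Sum>k<q. f (bs[m := a, k := b \<cdot> bs[m := a] ! k]))
          = (\<Sum>i<m. f (bs[i := b \<cdot> bs ! i, m := a])) + f (bs[m := b \<cdot> a])"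
        using bs by (simp add: m(2) list_update_swap)
      show ?thesis
        unfolding D_def 1 2 using module_associator_mid[of a "f (bs[m := b])" y]
        by (simp add: ract_lin algebra_simps)
    qed
    show ?thesis
      unfolding D'[of a b] D'[of b a] by (simp add: algebra_simps)
  qed
  have "- act_associator a b f bs = - act_associator b a f bs"
    unfolding expand[of a b] expand[of b a] A C D by (simp add: algebra_simps)
  then show ?thesis by simp
qed

section \<open>The square of the coboundary\<close>

text \<open>
  In the \<open>k\<close>-th summand of \<open>coboundary f\<close>, the substitution \<open>b\<^sub>k \<mapsto> a \<cdot> b\<^sub>k\<close> changes the acting
  element, which yields \<open>- (a \<cdot> b\<^sub>k) f\<close>, as substitutions enter with a minus sign; all other parts of the action of \<open>a\<close> affect only the list
  without \<open>b\<^sub>k\<close> and add up to \<open>a (b\<^sub>k f)\<close>.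
\<close>
lemma curried_act_coboundary:
  assumes bs: "length bs = Suc q" and q: "q \<ge> 1"
  shows "curried_act a (coboundary f) bs =
    - (\<Sum>k<q. scaleW ((-1) ^ Suc k) (act_associator a (bs ! k) f (omit k bs)))"
proof -
  have cob: "coboundary f xs = (\<Sum>k<q. scaleW ((-1) ^ Suc k) (curried_act (xs ! k) f (omit k xs)))"
    if "length xs = Suc q" for xs
    using that by (simp add: coboundary_eq_sum_curried_act)
  have "curried_act a (coboundary f) bs = (\<Sum>k<q. scaleW ((-1) ^ Suc k)
      (a \<rhd> curried_act (bs ! k) f (omit k bs)
       - (\<Sum>i<Suc q. curried_act (bs[i := a \<cdot> bs ! i] ! k) f (omit k (bs[i := a \<cdot> bs ! i])))
       + curried_act (bs[q := a] ! k) f (omit k (bs[q := a])) \<lhd> (bs ! q)))"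
    unfolding curried_act_def[of a "coboundary f"] act_def[of a "coboundary f"]
    by (simp only: cob bs length_list_update diff_Suc_1 lact_lin ract_lin
        W.scale_right_diff_distrib W.scale_right_distrib sum.distrib sum_subtractf
        W.scale_sum_right sum.swap[of _ _ "{..<Suc q}"])
  also have "\<dots> = (\<Sum>k<q. scaleW ((-1) ^ Suc k) (- act_associator a (bs ! k) f (omit k bs)))"
  proof (rule sum.cong[OF refl])
    fix k assume "k \<in> {..<q}"
    then have k: "k < q" by simp
    define cs where "cs = omit k bs"
    have cs: "length cs = q" using bs k by (simp add: cs_def length_omit)
    have "(\<Sum>i<Suc q. curried_act (bs[i := a \<cdot> bs ! i] ! k) f (omit k (bs[i := a \<cdot> bs ! i])))
      = curried_act (a \<cdot> bs ! k) f cs + (\<Sum>i<q. curried_act (bs ! k) f (cs[i := a \<cdot> cs ! i]))"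
      using k bs
      by (subst sum_split_skip[of k q])
        (auto simp: cs_def omit_update_self omit_update_skip nth_omit)
    moreover have "q = skip k (q - 1)" using k by (simp add: skip_def)
    then have "omit k (bs[q := a]) = cs[q - 1 := a]" "bs ! q = cs ! (q - 1)"
      using omit_update_skip[of k bs "q - 1" a] nth_omit[of "q - 1" bs k] k bs
      by (auto simp: cs_def)
    ultimately show "scaleW ((-1) ^ Suc k)
      (a \<rhd> curried_act (bs ! k) f (omit k bs)
       - (\<Sum>i<Suc q. curried_act (bs[i := a \<cdot> bs ! i] ! k) f (omit k (bs[i := a \<cdot> bs ! i])))
       + curried_act (bs[q := a] ! k) f (omit k (bs[q := a])) \<lhd> (bs ! q))
      = scaleW ((-1) ^ Suc k) (- act_associator a (bs ! k) f (omit k bs))"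
      using k cs
      by (simp add: act_associator_def curried_act_def[of a "curried_act (bs ! k) f"]
          act_def[of a "curried_act (bs ! k) f"] flip: cs_def)
  qed
  finally show ?thesis by (simp add: sum_negf)
qed

lemma coboundary_coboundary:
  assumes f: "f \<in> cochains q" and q: "q \<ge> 1"
  shows "coboundary (coboundary f) xs = 0"
proof (cases "length xs = q + 2")
  case False
  have "coboundary (coboundary f) \<in> cochains (q + 1 + 1)"
    by (intro coboundary_cochain f q) simp
  then show ?thesis using False by (intro cochain_eq_0) auto
next
  case xs: True
  define h where "h j k = scaleW ((-1) ^ Suc (j + k))
    (act_associator (xs ! j) (omit j xs ! k) f (omit k (omit j xs)))" for j k
  have "coboundary (coboundary f) xs = (\<Sum>j<Suc q. \<Sum>k<q. h j k)"
    unfolding coboundary_eq_sum_curried_act[of "coboundary f"]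
  proof (rule sum.cong)
    fix j assume "j \<in> {..<Suc q}"
    then have "length (omit j xs) = Suc q" using xs by (simp add: length_omit)
    then show "scaleW ((-1) ^ Suc j) (curried_act (xs ! j) (coboundary f) (omit j xs)) = (\<Sum>k<q. h j k)"
      by (simp add: curried_act_coboundary[OF _ q] h_def W.scale_sum_right power_add sum_negf)
  qed (simp add: xs)
  also have "\<dots> = 0"
  proof (rule sum_sum_antisym_eq_0)
    fix j k assume jk: "j \<le> k" "k < q"
    have "omit (Suc k) xs ! j = xs ! j" "omit j xs ! k = xs ! Suc k"
      using jk xs by (simp_all add: nth_omit skip_def)
    moreover have "length (omit k (omit j xs)) = q"
      using jk xs by (simp add: length_omit)
    ultimately show "h (Suc k) j = - h j k"
      using jk xs act_associator_sym[OF f q, of "omit k (omit j xs)" "xs ! j" "xs ! Suc k"]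
      by (simp add: h_def omit_omit add.commute)
  qed
  finally show ?thesis .
qed

end

theorem lemma4p1:
  fixes scaleA :: "'f::field_char_0 \<Rightarrow> 'a::ab_group_add \<Rightarrow> 'a"
    and mul :: "'a \<Rightarrow> 'a \<Rightarrow> 'a"
    and scaleW :: "'f \<Rightarrow> 'w::ab_group_add \<Rightarrow> 'w"
    and lact :: "'a \<Rightarrow> 'w \<Rightarrow> 'w"
    and ract :: "'w \<Rightarrow> 'a \<Rightarrow> 'w"
    and q :: nat
    and f :: "'a list \<Rightarrow> 'w"
  assumes "KV_algebra scaleA mul"
    and "KV_module scaleA mul scaleW lact ract"
    and "q \<ge> 1"
    and "f \<in> KV_module.cochains scaleA scaleW q"
  shows "KV_module.coboundary mul scaleW lact ract f
           \<in> KV_module.cochains scaleA scaleW (q + 1) \<and>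
         KV_module.coboundary mul scaleW lact ract
           (KV_module.coboundary mul scaleW lact ract f) = (\<lambda>_. 0)"
proof -
  interpret KV_module scaleA mul scaleW lact ract by (fact assms(2))
  show ?thesis
    using coboundary_cochain coboundary_coboundary assms(3,4) by blast
qed

end
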